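(* Let $T$ be a forest (without loops) and let $A\in\mathcal S^+(T)$. Then $\mathrm{rk}(A)=\mathrm{st}_+(A)=2\,\mathrm{star}(T)$. In particular, $\mathrm{st}_+(T)=2\,\mathrm{star}(T)$.
   Context: $\mathrm{rk}$ is the usual rank of a real matrix. $\mathcal S_n^+$ is the set of symmetric entrywise nonnegative real $n\times n$ matrices. For $A\in\mathcal S_n^+$, $\mathrm{st}_+(A)$ is the minimal $k\ge 0$ such that $A=BCB^T$ with $B$ an entrywise nonnegative real $n\times k$ matrix and $C\in\mathcal S_k^+$ (the zero matrix has $\mathrm{st}_+=0$). The pattern graph $G(A)$ of $A$ has vertex set $[n]=\{1,\dots,n\}$ and $\{i,j\}\in E(G(A))$ iff $a_{ij}>0$ (a loop $\{i\}$ is present iff $a_{ii}>0$). For a finite graph $G$ with $n$ vertices (identified with $[n]$), $\mathcal S^+(G)=\{A\in\mathcal S_n^+: G(A)=G\}$ and $\mathrm{st}_+(G)=\min\{\mathrm{st}_+(A): A\in\mathcal S^+(G)\}$. For a simple graph $G$ without loops, an edge star cover of $G$ is a family $\{S_1,\dots,S_k\}$ of simple stars (subgraphs $K_{1,m}$, $m\ge1$) with $E(G)=\bigcup_{i=1}^kE(S_i)$; the edge star cover number $\mathrm{star}(G)$ is the minimal number of stars in an edge star cover of $G$. *)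

theory Defs
  imports Jordan_Normal_Form.DL_Rank
begin

text \<open>Undirected graphs, loops allowed: an edge is the set of its end points, so a loop at \<open>v\<close>
  is the singleton \<open>{v}\<close>. The vertices \<open>1, \<dots>, n\<close> of the mathematical text are \<open>0, \<dots>, n - 1\<close>
  here, as for matrix indices.\<close>

datatype 'a graph = Graph (verts: "'a set") (edges: "'a set set")

definition fin_graph :: "'a graph \<Rightarrow> bool" where
  "fin_graph G \<longleftrightarrow> finite (verts G) \<and>
     (\<forall>e\<in>edges G. \<exists>u\<in>verts G. \<exists>v\<in>verts G. e = {u, v})"

definition loopless :: "'a graph \<Rightarrow> bool" where
  "loopless G \<longleftrightarrow> (\<forall>v. {v} \<notin> edges G)"

definition subgraph_of :: "'a graph \<Rightarrow> 'a graph \<Rightarrow> bool" where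
  "subgraph_of H G \<longleftrightarrow> verts H \<subseteq> verts G \<and> edges H \<subseteq> edges G"

text \<open>Cycles of length at least 3, given by their list of pairwise distinct vertices.\<close>

definition is_cycle :: "'a graph \<Rightarrow> 'a list \<Rightarrow> bool" where
  "is_cycle G p \<longleftrightarrow> 3 \<le> length p \<and> distinct p \<and> set p \<subseteq> verts G \<and>
     (\<forall>i<length p. {p ! i, p ! (Suc i mod length p)} \<in> edges G)"

definition forest :: "'a graph \<Rightarrow> bool" where
  "forest G \<longleftrightarrow> fin_graph G \<and> loopless G \<and> (\<nexists>p. is_cycle G p)"

text \<open>A star \<open>K\<^bsub>1,m\<^esub>\<close> with \<open>m \<ge> 1\<close>: centre \<open>c\<close> and set of leaves \<open>L\<close>.\<close>

definition simple_star :: "'a graph \<Rightarrow> bool" where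
  "simple_star S \<longleftrightarrow> (\<exists>c L. finite L \<and> L \<noteq> {} \<and> c \<notin> L \<and>
     S = Graph (insert c L) ((\<lambda>x. {c, x}) ` L))"

definition edge_star_cover :: "'a graph \<Rightarrow> nat \<Rightarrow> (nat \<Rightarrow> 'a graph) \<Rightarrow> bool" where
  "edge_star_cover G k S \<longleftrightarrow>
     (\<forall>i\<in>{1..k}. simple_star (S i) \<and> subgraph_of (S i) G) \<and>
     edges G = (\<Union>i\<in>{1..k}. edges (S i))"

definition star :: "'a graph \<Rightarrow> nat" where
  "star G = (LEAST k. \<exists>S. edge_star_cover G k S)"

definition nonneg_mat :: "real mat \<Rightarrow> bool" where
  "nonneg_mat A \<longleftrightarrow> (\<forall>i<dim_row A. \<forall>j<dim_col A. 0 \<le> A $$ (i, j))"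

definition S_plus :: "nat \<Rightarrow> real mat set" where
  "S_plus n = {A \<in> carrier_mat n n. transpose_mat A = A \<and> nonneg_mat A}"

text \<open>For \<open>k = 0\<close> the product \<open>B * C * transpose_mat B\<close> is the zero matrix, so zero matrices have
  value \<open>0\<close>.\<close>

definition st_plus :: "real mat \<Rightarrow> nat" where
  "st_plus A = (LEAST k. \<exists>B\<in>carrier_mat (dim_row A) k. \<exists>C\<in>S_plus k.
     nonneg_mat B \<and> A = B * C * transpose_mat B)"

definition pattern_graph :: "real mat \<Rightarrow> nat graph" where
  "pattern_graph A = Graph {0..<dim_row A}
     {{i, j} | i j. i < dim_row A \<and> j < dim_col A \<and> 0 < A $$ (i, j)}"

definition S_plus_graph :: "nat graph \<Rightarrow> real mat set" where
  "S_plus_graph G = {A \<in> S_plus (card (verts G)). pattern_graph A = G}"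

definition st_plus_graph :: "nat graph \<Rightarrow> nat" where
  "st_plus_graph G = (LEAST k. \<exists>A\<in>S_plus_graph G. k = st_plus A)"

text \<open>The minima above are taken over nonempty sets.\<close>

lemma st_plus_exists:
  assumes "A \<in> S_plus n"
  shows "\<exists>k. \<exists>B\<in>carrier_mat (dim_row A) k. \<exists>C\<in>S_plus k.
     nonneg_mat B \<and> A = B * C * transpose_mat B"
proof -
  have A: "A \<in> carrier_mat n n" using assms by (simp add: S_plus_def)
  have "nonneg_mat (1\<^sub>m n)" by (simp add: nonneg_mat_def)
  moreover have "A = 1\<^sub>m n * A * transpose_mat (1\<^sub>m n)" using A by simp
  ultimately show ?thesis using assms A
    by (intro exI[of _ n] bexI[of _ "1\<^sub>m n"] bexI[of _ A]) auto
qed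

lemma S_plus_graph_nonempty:
  assumes "fin_graph G" "verts G = {0..<n}"
  shows "S_plus_graph G \<noteq> {}"
proof -
  define A :: "real mat" where "A = mat n n (\<lambda>(i, j). if {i, j} \<in> edges G then 1 else 0)"
  have "A \<in> S_plus n"
    by (auto simp: A_def S_plus_def nonneg_mat_def insert_commute)
  moreover have "{{i, j} | i j. i < n \<and> j < n \<and> 0 < A $$ (i, j)} = edges G"
  proof
    show "{{i, j} | i j. i < n \<and> j < n \<and> 0 < A $$ (i, j)} \<subseteq> edges G"
      by (auto simp: A_def split: if_splits)
    show "edges G \<subseteq> {{i, j} | i j. i < n \<and> j < n \<and> 0 < A $$ (i, j)}"
    proof
      fix e assume e: "e \<in> edges G"
      then obtain u v where "u < n" "v < n" "e = {u, v}"
        using assms by (auto simp: fin_graph_def)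
      with e show "e \<in> {{i, j} | i j. i < n \<and> j < n \<and> 0 < A $$ (i, j)}"
        by (intro CollectI exI[of _ u] exI[of _ v]) (simp add: A_def)
    qed
  qed
  then have "pattern_graph A = G"
    using assms by (cases G) (simp add: pattern_graph_def A_def)
  ultimately show ?thesis using assms by (auto simp: S_plus_graph_def)
qed

lemma edge_star_cover_exists:
  assumes "fin_graph G" "loopless G"
  shows "\<exists>k S. edge_star_cover G k S"
proof -
  have E: "\<exists>u\<in>verts G. \<exists>v\<in>verts G. u \<noteq> v \<and> e = {u, v}" if e: "e \<in> edges G" for e
  proof -
    obtain u v where "u \<in> verts G" "v \<in> verts G" "e = {u, v}"
      using assms(1) e by (auto simp: fin_graph_def)
    moreover from this have "u \<noteq> v" using assms(2) e by (auto simp: loopless_def)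
    ultimately show ?thesis by blast
  qed
  have "edges G \<subseteq> Pow (verts G)" using E by blast
  then have "finite (edges G)"
    using assms(1) by (meson fin_graph_def finite_Pow_iff finite_subset)
  then obtain h where h: "bij_betw h {1..card (edges G)} (edges G)"
    using ex_bij_betw_nat_finite_1 by blast
  define S where "S i = Graph (h i) {h i}" for i
  have "simple_star (S i) \<and> subgraph_of (S i) G" if i: "i \<in> {1..card (edges G)}" for i
  proof -
    have "h i \<in> edges G" using h i by (auto simp: bij_betw_def)
    then obtain u v where uv: "u \<in> verts G" "v \<in> verts G" "u \<noteq> v" "h i = {u, v}" "{u, v} \<in> edges G"
      using E by metis
    have "simple_star (S i)" unfolding simple_star_def
      by (rule exI[of _ u], rule exI[of _ "{v}"]) (use uv in \<open>simp add: S_def\<close>)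
    then show ?thesis using uv by (simp add: S_def subgraph_of_def)
  qed
  moreover have "edges G = (\<Union>i\<in>{1..card (edges G)}. edges (S i))"
    using h by (auto simp: S_def bij_betw_def)
  ultimately show ?thesis unfolding edge_star_cover_def by blast
qed

end

theory Submission
  imports Defs
begin

text \<open>Three inequalities close a cycle: \<open>rk A \<le> st\<^sub>+ A \<le> 2 star T \<le> rk A\<close>.

  The first holds for every \<open>A\<close>, because \<open>A = B C B\<^sup>T\<close> factors through a space of dimension
  \<open>k\<close> (\<open>rank_le_st_plus\<close>). The second holds for every loopless pattern: a star with
  centre \<open>c\<close> contributes a symmetric matrix supported on row and column \<open>c\<close>, hence of the form
  \<open>e\<^sub>c h\<^sup>T + h e\<^sub>c\<^sup>T\<close>, which costs two columns of \<open>B\<close> (\<open>st_plus_le_two_mult_cover\<close>).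

  The third is where \<open>T\<close> has to be a forest (\<open>two_star_le_rank\<close>). Peel the forest: pick a leaf \<open>v\<close>
  with neighbour \<open>u\<close>, take the star of all edges at \<open>u\<close>, delete these edges, and repeat. After \<open>k\<close>
  rounds there is a cover by \<open>k\<close> stars and there are pairs \<open>(v\<^sub>1, u\<^sub>1), \<dots>, (v\<^sub>k, u\<^sub>k)\<close> of leaves and
  neighbours. Take the rows in the order \<open>v\<^sub>1, \<dots>, v\<^sub>k, u\<^sub>k, \<dots>, u\<^sub>1\<close> and the columns in the order
  \<open>u\<^sub>1, \<dots>, u\<^sub>k, v\<^sub>k, \<dots>, v\<^sub>1\<close>. These \<open>2 k\<close> vertices are distinct, since both ends of \<open>{v\<^sub>i, u\<^sub>i}\<close> are
  isolated after round \<open>i\<close>, and every neighbour of \<open>v\<^sub>i\<close> is one of \<open>u\<^sub>1, \<dots>, u\<^sub>i\<close>. So this square submatrix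
  of \<open>A\<close> is lower triangular, and its diagonal entries sit at edges and are nonzero. It has full rank
  \<open>2 k \<ge> 2 star T\<close>. The matching \<open>{v\<^sub>i, u\<^sub>i}\<close> and the vertex cover \<open>{u\<^sub>1, \<dots>, u\<^sub>k}\<close> have
  the same size, as in Koenig's theorem, and arise together from the order of the leaves.\<close>

section \<open>Rank bounds\<close>

text \<open>If \<open>r > k\<close> columns of \<open>B D\<close> were independent, they would form a matrix \<open>B E\<close> with \<open>E\<close> of size
  \<open>k \<times> r\<close>, and a nonzero kernel vector of the wide matrix \<open>E\<close> would be a linear dependency between
  them.\<close>

lemma (in vec_space) rank_mult_le_inner_dim:
  assumes B: "B \<in> carrier_mat n k" and D: "D \<in> carrier_mat k m"
  shows "rank (B * D) \<le> k"
proof (rule ccontr)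
  assume "\<not> rank (B * D) \<le> k"
  have A: "B * D \<in> carrier_mat n m" using B D by simp
  obtain U where U: "maximal U (\<lambda>W. W \<subseteq> set (cols (B * D)) \<and> lin_indpt W)"
    using maximal_exists_superset[of "set (cols (B * D))" "\<lambda>W. W \<subseteq> set (cols (B * D)) \<and> lin_indpt W" "{}"]
    by (auto simp: lin_dep_def)
  then have UA: "U \<subseteq> set (cols (B * D))" and li: "lin_indpt U" by (auto simp: maximal_def)
  have "finite U" using UA finite_subset by blast
  then obtain us where us: "set us = U" "distinct us" using finite_distinct_list by blast
  define r where "r = length us"
  have "rank (B * D) = card U" using rank_card_indpt[OF A U] .
  with \<open>\<not> rank (B * D) \<le> k\<close> have kr: "k < r" unfolding r_def using us distinct_card by fastforce
  have "\<exists>w \<in> carrier_vec k. us ! j = B *\<^sub>v w" if "j < r" for j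
  proof -
    have "us ! j \<in> set (cols (B * D))" using that UA us unfolding r_def by auto
    then obtain i where "i < m" "us ! j = col (B * D) i"
      using D by (auto simp: cols_def)
    then show ?thesis using B D by (intro bexI[of _ "col D i"]) (auto simp: col_mult2[OF B D])
  qed
  then obtain w where w: "\<And>j. j < r \<Longrightarrow> w j \<in> carrier_vec k" "\<And>j. j < r \<Longrightarrow> us ! j = B *\<^sub>v w j"
    by metis
  define E where "E = mat_of_cols k (map w [0..<r])"
  \<comment> \<open>\<open>E\<close> padded with zero rows to a square matrix, so that its kernel is detected by the determinant.\<close>
  define F where "F = mat r r (\<lambda>(i, j). if i < k then w j $ i else 0)"
  have E: "E \<in> carrier_mat k r" by (auto simp: E_def)
  have F: "F \<in> carrier_mat r r" by (auto simp: F_def)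
  have "F = mat\<^sub>r r r (\<lambda>i. if i = k then 0\<^sub>v r else row F i)"
    by (rule eq_matI) (use kr in \<open>auto simp: F_def\<close>)
  moreover have "det (mat\<^sub>r r r (\<lambda>i. if i = k then 0\<^sub>v r else row F i)) = 0"
    by (rule det_row_0[OF kr]) (use F in auto)
  ultimately have "det F = 0" by simp
  then obtain v where v: "v \<in> carrier_vec r" "v \<noteq> 0\<^sub>v r" "F *\<^sub>v v = 0\<^sub>v r"
    using det_0_iff_vec_prod_zero_field[OF F] by blast
  have "E *\<^sub>v v = 0\<^sub>v k"
  proof (rule eq_vecI)
    fix i assume i: "i < dim_vec (0\<^sub>v k :: 'a vec)"
    then have ir: "i < r" using kr by simp
    have "row E i = row F i" using i kr by (auto simp: E_def F_def mat_of_cols_index)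
    then have "(E *\<^sub>v v) $ i = (F *\<^sub>v v) $ i" using i ir E F by simp
    then show "(E *\<^sub>v v) $ i = 0\<^sub>v k $ i" using v ir i by simp
  qed (use E in auto)
  have M: "mat_of_cols n us = B * E"
  proof (rule eq_matI)
    fix i j assume ij: "i < dim_row (B * E)" "j < dim_col (B * E)"
    then have "j < r" "i < n" using E B by auto
    moreover have "col E j = w j" using w(1) \<open>j < r\<close> by (simp add: E_def)
    ultimately show "mat_of_cols n us $$ (i, j) = (B * E) $$ (i, j)"
      using w(2)[of j] B E by (simp add: mat_of_cols_index r_def)
  qed (use B E r_def in auto)
  have "mat_of_cols n us *\<^sub>v v = B *\<^sub>v (E *\<^sub>v v)" using M assoc_mult_mat_vec[OF B E v(1)] by simp
  also have "\<dots> = 0\<^sub>v n" using \<open>E *\<^sub>v v = 0\<^sub>v k\<close> B by auto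
  finally have z: "mat_of_cols n us *\<^sub>v v = 0\<^sub>v n" .
  have "set us \<subseteq> carrier_vec n" using UA us cols_dim[of "B * D"] B by auto
  then have "cols (mat_of_cols n us) = us" by simp
  then have "lin_dep (set us)"
    using lin_depI[of "mat_of_cols n us" r v] v z us by (auto simp: r_def)
  then show False using li us by simp
qed

text \<open>The entries at the rows \<open>fst p\<close> and columns \<open>snd p\<close>, in the order of the list, form a lower
  triangular matrix with nonzero diagonal; a dependency between the chosen columns of \<open>A\<close> would
  restrict to one between the columns of this nonsingular matrix.\<close>

lemma (in vec_space) triangular_entries_le_rank:
  assumes A: "A \<in> carrier_mat n m"
    and ps: "set ps \<subseteq> {0..<n} \<times> {0..<m}"
    and diag: "\<And>p. p \<in> set ps \<Longrightarrow> A $$ p \<noteq> 0"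
    and tri: "sorted_wrt (\<lambda>p q. A $$ (fst p, snd q) = 0) ps"
  shows "length ps \<le> rank A"
proof -
  define r where "r = length ps"
  define us where "us = map (\<lambda>p. col A (snd p)) ps"
  define L where "L = mat r r (\<lambda>(i, j). A $$ (fst (ps ! i), snd (ps ! j)))"
  have pj: "fst (ps ! j) < n" "snd (ps ! j) < m" if "j < r" for j
    using ps nth_mem[of j ps] that by (auto simp: r_def mem_Times_iff subset_eq)
  have dg: "A $$ (fst (ps ! j), snd (ps ! j)) \<noteq> 0" if "j < r" for j
    using diag[of "ps ! j"] that by (auto simp: r_def)
  have tr: "A $$ (fst (ps ! i), snd (ps ! j)) = 0" if "i < j" "j < r" for i j
    using tri that by (auto simp: r_def sorted_wrt_iff_nth_less)
  have neq: "us ! i \<noteq> us ! j" if "i < j" "j < r" for i j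
  proof
    assume "us ! i = us ! j"
    then have "col A (snd (ps ! i)) $ fst (ps ! i) = col A (snd (ps ! j)) $ fst (ps ! i)"
      using that by (simp add: us_def r_def)
    then show False using tr[OF that] dg[of i] pj[of i] pj[of j] that A by auto
  qed
  have dist: "distinct us"
    unfolding distinct_conv_nth
    by (metis neq length_map linorder_neqE_nat r_def us_def)
  have usn: "set us \<subseteq> carrier_vec n" using A by (auto simp: us_def)
  have usA: "set us \<subseteq> set (cols A)"
    using A ps by (force simp: us_def cols_def)
  have L: "L \<in> carrier_mat r r" by (simp add: L_def)
  have "det L = prod_list (diag_mat L)"
    by (rule det_lower_triangular[OF _ L]) (auto simp: L_def tr)
  also have "\<dots> \<noteq> 0" using dg by (auto simp: prod_list_zero_iff diag_mat_def L_def)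
  finally have dL: "det L \<noteq> 0" .
  have "lin_indpt (set us)"
  proof
    assume "lin_dep (set us)"
    moreover have "cols (mat_of_cols n us) = us" using usn by simp
    moreover have "mat_of_cols n us \<in> carrier_mat n r" by (auto simp: us_def r_def)
    ultimately obtain v where v: "v \<in> carrier_vec r" "v \<noteq> 0\<^sub>v r" "mat_of_cols n us *\<^sub>v v = 0\<^sub>v n"
      using lin_depE[of "mat_of_cols n us" r] dist by metis
    have "L *\<^sub>v v = 0\<^sub>v r"
    proof (rule eq_vecI)
      fix i assume "i < dim_vec (0\<^sub>v r :: 'a vec)"
      then have i: "i < r" by simp
      have "row L i = row (mat_of_cols n us) (fst (ps ! i))"
        using i pj A by (auto simp: L_def us_def r_def mat_of_cols_index)
      then have "(L *\<^sub>v v) $ i = (mat_of_cols n us *\<^sub>v v) $ fst (ps ! i)"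
        using i pj L by simp
      then show "(L *\<^sub>v v) $ i = 0\<^sub>v r $ i" using v(3) i pj by simp
    qed (use L in auto)
    then show False using det_0_iff_vec_prod_zero_field[OF L] dL v by blast
  qed
  then have "card (set us) \<le> rank A" using rank_ge_card_indpt[OF A usA] by simp
  then show ?thesis using distinct_card[OF dist] by (simp add: us_def)
qed

lemma rank_le_st_plus:
  assumes "A \<in> S_plus n"
  shows "vec_space.rank n A \<le> st_plus A"
proof -
  have A: "A \<in> carrier_mat n n" using assms by (simp add: S_plus_def)
  obtain B C where B: "B \<in> carrier_mat n (st_plus A)" and C: "C \<in> S_plus (st_plus A)"
    and eq: "A = B * C * transpose_mat B"
    using LeastI_ex[OF st_plus_exists[OF assms]] A unfolding st_plus_def by auto
  have C': "C \<in> carrier_mat (st_plus A) (st_plus A)" using C by (simp add: S_plus_def)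
  have "A = B * (C * transpose_mat B)" using eq assoc_mult_mat[OF B C'] B by simp
  then show ?thesis
    using vec_space.rank_mult_le_inner_dim[OF B, of "C * transpose_mat B" n] B C' by simp
qed

section \<open>Leaves and star covers of forests\<close>

lemma fin_graph_edge_subset: "fin_graph G \<Longrightarrow> e \<in> edges G \<Longrightarrow> e \<subseteq> verts G"
  unfolding fin_graph_def by (metis empty_subsetI insert_subset)

text \<open>The first vertex \<open>v\<close> of a longest path is a leaf: a neighbour of \<open>v\<close> off the path would
  prolong the path, and one on the path beyond the second vertex would close a cycle.\<close>

lemma forest_leafE:
  assumes "forest T" and "edges T \<noteq> {}"
  obtains u v where "{v, u} \<in> edges T" and "\<And>w. {v, w} \<in> edges T \<Longrightarrow> w = u"
proof -
  have G: "fin_graph T" "loopless T" and nc: "\<And>p. \<not> is_cycle T p"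
    using assms(1) by (simp_all add: forest_def)
  have fin: "finite (verts T)" using G(1) by (simp add: fin_graph_def)
  have nl: "\<And>x. {x} \<notin> edges T" using G(2) by (simp add: loopless_def)
  have ev: "\<And>e. e \<in> edges T \<Longrightarrow> e \<subseteq> verts T" using fin_graph_edge_subset[OF G(1)] .
  define path where "path p \<longleftrightarrow> distinct p \<and> set p \<subseteq> verts T \<and> successively (\<lambda>x y. {x, y} \<in> edges T) p" for p
  obtain e where e: "e \<in> edges T" using assms(2) by blast
  then obtain a b where ab: "{a, b} \<in> edges T"
    using G(1) by (force simp: fin_graph_def)
  have "path [a, b]" using ab nl[of a] ev[OF ab] by (auto simp: path_def)
  moreover have "\<forall>q. path q \<longrightarrow> length q < Suc (card (verts T))"
    using fin by (metis card_mono distinct_card le_imp_less_Suc path_def)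
  ultimately obtain p where p: "path p" and mx: "\<And>q. path q \<Longrightarrow> length q \<le> length p"
    using ex_has_greatest_nat[of path "[a, b]" length] by blast
  have "2 \<le> length p" using mx[OF \<open>path [a, b]\<close>] by simp
  then obtain v u r where pv: "p = v # u # r" by (metis Suc_le_length_iff numeral_2_eq_2)
  have vu: "{v, u} \<in> edges T" using p by (simp add: path_def pv)
  have "w = u" if w: "{v, w} \<in> edges T" for w
  proof (rule ccontr)
    assume "w \<noteq> u"
    have "w \<noteq> v" using w nl by auto
    have "w \<in> set p"
    proof (rule ccontr)
      assume "w \<notin> set p"
      then have "path (w # p)" using p w ev[OF w] by (auto simp: path_def pv insert_commute)
      then show False using mx by fastforce
    qed
    then obtain xs ys where r: "r = xs @ w # ys" using \<open>w \<noteq> u\<close> \<open>w \<noteq> v\<close> pv by (auto dest: split_list)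
    define c where "c = v # u # xs @ [w]"
    have cp: "p = c @ ys" by (simp add: c_def pv r)
    have "{c ! i, c ! (Suc i mod length c)} \<in> edges T" if i: "i < length c" for i
    proof (cases "Suc i < length c")
      case True
      have "successively (\<lambda>x y. {x, y} \<in> edges T) c"
        using p unfolding path_def cp successively_append_iff by blast
      then show ?thesis using True by (simp add: successively_conv_nth)
    next
      case False
      then have "Suc i = length c" using i by simp
      then have "c ! i = w" "Suc i mod length c = 0"
        by (auto simp: c_def nth_append nth_Cons')
      then show ?thesis using w by (simp add: c_def insert_commute)
    qed
    moreover have "distinct c" "set c \<subseteq> verts T" using p by (auto simp: path_def cp)
    ultimately have "is_cycle T c" by (simp add: is_cycle_def c_def)
    then show False using nc by blast
  qed
  then show thesis using that vu by blast
qed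

definition isolate :: "'a \<Rightarrow> 'a graph \<Rightarrow> 'a graph" where
  "isolate u G = Graph (verts G) {e \<in> edges G. u \<notin> e}"

lemma forest_isolate: "forest G \<Longrightarrow> forest (isolate u G)"
  by (auto simp: forest_def fin_graph_def loopless_def is_cycle_def isolate_def)

text \<open>The deleted edges form one star; the edge \<open>{v, u}\<close> makes sure that it has a leaf.\<close>

lemma edge_star_cover_isolate:
  assumes G: "fin_graph G" "loopless G" and uv: "{v, u} \<in> edges G"
    and S: "edge_star_cover (isolate u G) k S"
  shows "\<exists>S'. edge_star_cover G (Suc k) S'"
proof -
  define N where "N = {x. {u, x} \<in> edges G}"
  define Su where "Su = Graph (insert u N) ((\<lambda>x. {u, x}) ` N)"
  have ev: "\<And>e. e \<in> edges G \<Longrightarrow> e \<subseteq> verts G" using fin_graph_edge_subset[OF G(1)] .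
  have Nv: "N \<subseteq> verts G" using ev by (auto simp: N_def)
  have "finite N" using Nv G(1) finite_subset unfolding fin_graph_def by blast
  moreover have vN: "v \<in> N" using uv by (simp add: N_def insert_commute)
  moreover have "u \<notin> N" using G(2) by (simp add: N_def loopless_def)
  ultimately have "simple_star Su" unfolding simple_star_def Su_def by blast
  moreover have "subgraph_of Su G"
    using Nv ev[OF uv] by (auto simp: subgraph_of_def Su_def N_def)
  moreover have eS: "edges Su = {e \<in> edges G. u \<in> e}"
  proof
    show "{e \<in> edges G. u \<in> e} \<subseteq> edges Su"
    proof
      fix e assume e: "e \<in> {e \<in> edges G. u \<in> e}"
      then obtain a b where ab: "e = {a, b}" using G unfolding fin_graph_def by blast
      then have "e = {u, a} \<or> e = {u, b}" using e by auto
      then show "e \<in> edges Su" using e by (auto simp: Su_def N_def)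
    qed
  qed (auto simp: Su_def N_def)
  moreover have "edges G = edges Su \<union> edges (isolate u G)" by (auto simp: eS isolate_def)
  moreover have "{1..Suc k} = insert (Suc k) {1..k}" by auto
  moreover have "subgraph_of H G" if "subgraph_of H (isolate u G)" for H
    using that by (auto simp: subgraph_of_def isolate_def)
  ultimately have "edge_star_cover G (Suc k) (S(Suc k := Su))"
    using S by (simp add: edge_star_cover_def)
  then show ?thesis by blast
qed

text \<open>In the induction step the leaf \<open>v\<close> and its neighbour \<open>u\<close> wrap the list of the smaller forest
  as \<open>(v, u) # ps @ [(u, v)]\<close>. All edges of the smaller forest avoid \<open>u\<close>, so \<open>u\<close> does not occur in
  \<open>ps\<close>; as \<open>u\<close> is the only neighbour of \<open>v\<close>, no edge joins \<open>v\<close> to an entry of \<open>ps\<close>. These are all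
  the new conditions, since nothing comes after the last pair \<open>(u, v)\<close> and nothing before the first
  pair \<open>(v, u)\<close>.\<close>

lemma forest_star_cover_triangular:
  assumes "forest T"
  shows "\<exists>k S ps. edge_star_cover T k S \<and> length ps = 2 * k \<and>
    (\<forall>p\<in>set ps. {fst p, snd p} \<in> edges T) \<and>
    sorted_wrt (\<lambda>p q. {fst p, snd q} \<notin> edges T) ps"
  using assms
proof (induction "card (edges T)" arbitrary: T rule: less_induct)
  case less
  have G: "fin_graph T" "loopless T" using less.prems by (auto simp: forest_def)
  show ?case
  proof (cases "edges T = {}")
    case True
    then have "edge_star_cover T 0 S" for S by (simp add: edge_star_cover_def)
    then show ?thesis by (intro exI[of _ 0] exI[of _ undefined] exI[of _ "[]"]) simp
  next
    case False
    obtain u v where vu: "{v, u} \<in> edges T" and leaf: "\<And>w. {v, w} \<in> edges T \<Longrightarrow> w = u"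
      using forest_leafE[OF less.prems False] by blast
    have "finite (edges T)"
      using fin_graph_edge_subset[OF G(1)] G(1)
      by (intro finite_subset[of "edges T" "Pow (verts T)"]) (auto simp: fin_graph_def)
    moreover have "edges (isolate u T) \<subset> edges T" using vu by (auto simp: isolate_def)
    ultimately have "card (edges (isolate u T)) < card (edges T)" by (rule psubset_card_mono)
    then obtain k S ps where S: "edge_star_cover (isolate u T) k S" and len: "length ps = 2 * k"
      and diag: "\<forall>p\<in>set ps. {fst p, snd p} \<in> edges (isolate u T)"
      and tri: "sorted_wrt (\<lambda>p q. {fst p, snd q} \<notin> edges (isolate u T)) ps"
      using less.hyps forest_isolate[OF less.prems] by blast
    obtain S' where S': "edge_star_cover T (Suc k) S'"
      using edge_star_cover_isolate[OF G vu S] by blast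
    have ps: "{fst p, snd p} \<in> edges T" "fst p \<noteq> u" "snd p \<noteq> u" if "p \<in> set ps" for p
      using diag that by (auto simp: isolate_def)
    \<comment> \<open>An edge of \<open>T\<close> between entries of \<open>ps\<close> avoids \<open>u\<close>, so it survives in \<open>isolate u T\<close>.\<close>
    have tri': "sorted_wrt (\<lambda>p q. {fst p, snd q} \<notin> edges T) ps"
      by (rule sorted_wrt_mono_rel[OF _ tri]) (auto simp: isolate_def dest: ps)
    have "{v} \<notin> edges T" using G(2) by (simp add: loopless_def)
    moreover have "{v, snd p} \<notin> edges T" "{fst p, v} \<notin> edges T" if "p \<in> set ps" for p
      using leaf ps[OF that] by (auto simp: insert_commute)
    ultimately have "sorted_wrt (\<lambda>p q. {fst p, snd q} \<notin> edges T) ((v, u) # ps @ [(u, v)])"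
      using tri' by (auto simp: sorted_wrt_append)
    moreover have "\<forall>p\<in>set ((v, u) # ps @ [(u, v)]). {fst p, snd p} \<in> edges T"
      using ps vu by (auto simp: insert_commute)
    ultimately show ?thesis using S' len
      by (intro exI[of _ "Suc k"] exI[of _ S'] exI[of _ "(v, u) # ps @ [(u, v)]"]) simp
  qed
qed

section \<open>Pattern graphs, rank and star covers\<close>

lemma pattern_graph_edge_iff:
  assumes "A \<in> S_plus n" "pattern_graph A = G" "i < n" "j < n"
  shows "{i, j} \<in> edges G \<longleftrightarrow> A $$ (i, j) \<noteq> 0"
proof -
  have A: "A \<in> carrier_mat n n" and sym: "transpose_mat A = A" and nn: "0 \<le> A $$ (i, j)"
    using assms by (auto simp: S_plus_def nonneg_mat_def)
  have s: "A $$ (j, i) = A $$ (i, j)" if "i < n" "j < n" for i j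
    using index_transpose_mat(1)[of i A j] A that by (simp add: sym)
  have "{i, j} \<in> edges G \<longleftrightarrow> 0 < A $$ (i, j)"
    using assms(2-4) A s[OF assms(3,4)] by (fastforce simp: pattern_graph_def doubleton_eq_iff)
  then show ?thesis using nn by auto
qed

lemma two_star_le_rank:
  assumes "forest T" and A: "A \<in> S_plus n" "pattern_graph A = T"
  shows "2 * star T \<le> vec_space.rank n A"
proof -
  have An: "A \<in> carrier_mat n n" using A by (simp add: S_plus_def)
  obtain k S ps where S: "edge_star_cover T k S" and len: "length ps = 2 * k"
    and diag: "\<forall>p\<in>set ps. {fst p, snd p} \<in> edges T"
    and tri: "sorted_wrt (\<lambda>p q. {fst p, snd q} \<notin> edges T) ps"
    using forest_star_cover_triangular[OF assms(1)] by blast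
  have ev: "x < n" "y < n" if "{x, y} \<in> edges T" for x y
    using that A An by (auto simp: pattern_graph_def doubleton_eq_iff)
  have sub: "set ps \<subseteq> {0..<n} \<times> {0..<n}" using diag ev by force
  have "length ps \<le> vec_space.rank n A"
  proof (rule vec_space.triangular_entries_le_rank[OF An sub])
    show "A $$ p \<noteq> 0" if "p \<in> set ps" for p
      using pattern_graph_edge_iff[OF A, of "fst p" "snd p"] diag that ev[of "fst p" "snd p"] by simp
    show "sorted_wrt (\<lambda>p q. A $$ (fst p, snd q) = 0) ps"
    proof (rule sorted_wrt_mono_rel[OF _ tri])
      fix p q assume "p \<in> set ps" "q \<in> set ps" "{fst p, snd q} \<notin> edges T"
      then show "A $$ (fst p, snd q) = 0"
        using pattern_graph_edge_iff[OF A, of "fst p" "snd q"] sub by force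
    qed
  qed
  moreover have "star T \<le> k" unfolding star_def by (rule Least_le) (use S in blast)
  ultimately show ?thesis using len by simp
qed

text \<open>A sum of \<open>k\<close> terms \<open>g h\<^sup>T + h g\<^sup>T\<close> factors through dimension \<open>2 k\<close>: take
  the \<open>g i\<close> followed by the \<open>h i\<close> as the columns of \<open>B\<close>, and let \<open>C\<close> be the permutation matrix
  that exchanges the two halves.\<close>

lemma st_plus_le_two_mult_swap_sum:
  fixes g h :: "nat \<Rightarrow> nat \<Rightarrow> real"
  assumes A: "A \<in> carrier_mat n n"
    and nonneg: "\<And>i x. i < k \<Longrightarrow> x < n \<Longrightarrow> 0 \<le> g i x" "\<And>i x. i < k \<Longrightarrow> x < n \<Longrightarrow> 0 \<le> h i x"
    and sum: "\<And>x y. x < n \<Longrightarrow> y < n \<Longrightarrow> A $$ (x, y) = (\<Sum>i<k. g i x * h i y + h i x * g i y)"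
  shows "st_plus A \<le> 2 * k"
proof -
  define B where "B = mat n (2 * k) (\<lambda>(x, i). if i < k then g i x else h (i - k) x)"
  define C :: "real mat" where "C = mat (2 * k) (2 * k) (\<lambda>(i, j). if j = i + k \<or> i = j + k then 1 else 0)"
  have B: "B \<in> carrier_mat n (2 * k)" by (simp add: B_def)
  have C: "C \<in> S_plus (2 * k)" by (auto simp: C_def S_plus_def nonneg_mat_def)
  have C': "C \<in> carrier_mat (2 * k) (2 * k)" by (simp add: C_def)
  have nB: "nonneg_mat B" using nonneg by (auto simp: nonneg_mat_def B_def)
  have split: "(\<Sum>i<2 * k. w i) = (\<Sum>i<k. w i) + (\<Sum>i<k. w (i + k))" for w :: "nat \<Rightarrow> real"
  proof -
    have "{..<2 * k} = {..<k} \<union> (\<lambda>i. i + k) ` {..<k}"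
    proof (intro equalityI subsetI)
      fix x assume "x \<in> {..<2 * k}"
      then show "x \<in> {..<k} \<union> (\<lambda>i. i + k) ` {..<k}"
        by (cases "x < k") (auto intro!: image_eqI[of _ _ "x - k"])
    qed auto
    moreover have "(\<Sum>i\<in>(\<lambda>i. i + k) ` {..<k}. w i) = (\<Sum>i<k. w (i + k))"
      by (subst sum.reindex) (auto simp: inj_on_def)
    ultimately show ?thesis by (subst \<open>{..<2 * k} = _\<close>, subst sum.union_disjoint) auto
  qed
  have CB: "(C * transpose_mat B) $$ (i, y) = B $$ (y, if i < k then i + k else i - k)"
    if "i < 2 * k" "y < n" for i y
  proof -
    have "(C * transpose_mat B) $$ (i, y) = (\<Sum>j<2 * k. C $$ (i, j) * B $$ (y, j))"
      using that B C' by (simp add: scalar_prod_def lessThan_atLeast0)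
    also have "\<dots> = (\<Sum>j<2 * k. if j = (if i < k then i + k else i - k) then B $$ (y, j) else 0)"
      by (rule sum.cong) (use that in \<open>auto simp: C_def\<close>)
    also have "\<dots> = B $$ (y, if i < k then i + k else i - k)"
      using that by (subst sum.delta) auto
    finally show ?thesis .
  qed
  have "A = B * (C * transpose_mat B)"
  proof (rule eq_matI)
    fix x y assume "x < dim_row (B * (C * transpose_mat B))" "y < dim_col (B * (C * transpose_mat B))"
    then have xy: "x < n" "y < n" using B C' by auto
    have "(B * (C * transpose_mat B)) $$ (x, y)
        = (\<Sum>i<2 * k. B $$ (x, i) * (C * transpose_mat B) $$ (i, y))"
      using xy B C' by (simp add: scalar_prod_def lessThan_atLeast0)
    also have "\<dots> = (\<Sum>i<2 * k. B $$ (x, i) * B $$ (y, if i < k then i + k else i - k))"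
      using xy by (simp add: CB)
    also have "\<dots> = (\<Sum>i<k. B $$ (x, i) * B $$ (y, i + k)) + (\<Sum>i<k. B $$ (x, i + k) * B $$ (y, i))"
      by (simp add: split)
    also have "\<dots> = (\<Sum>i<k. B $$ (x, i) * B $$ (y, i + k) + B $$ (x, i + k) * B $$ (y, i))"
      by (simp add: sum.distrib)
    also have "\<dots> = A $$ (x, y)"
      unfolding sum[OF xy] by (rule sum.cong) (use xy in \<open>auto simp: B_def\<close>)
    finally show "A $$ (x, y) = (B * (C * transpose_mat B)) $$ (x, y)" by simp
  qed (use A B in auto)
  then have "A = B * C * transpose_mat B" using assoc_mult_mat[OF B C', of "transpose_mat B" n] B by simp
  moreover have "B \<in> carrier_mat (dim_row A) (2 * k)" using A B by simp
  ultimately show ?thesis unfolding st_plus_def using C nB by (blast intro: Least_le)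
qed

text \<open>A cover by \<open>k\<close> stars splits \<open>A\<close> into \<open>k\<close> matrices \<open>g h\<^sup>T + h g\<^sup>T\<close>, one per star: \<open>g\<close> is
  the unit vector of the centre and \<open>h\<close> holds the entries of \<open>A\<close> at the edges to the leaves. Since
  stars may share edges, each edge is first assigned to a single star.\<close>

lemma st_plus_le_two_mult_cover:
  assumes "loopless G" and A: "A \<in> S_plus n" "pattern_graph A = G"
    and S: "edge_star_cover G k S"
  shows "st_plus A \<le> 2 * k"
proof -
  have An: "A \<in> carrier_mat n n" and nn: "\<And>i j. i < n \<Longrightarrow> j < n \<Longrightarrow> 0 \<le> A $$ (i, j)"
    and tA: "transpose_mat A = A" using A by (auto simp: S_plus_def nonneg_mat_def)
  have sym: "A $$ (j, i) = A $$ (i, j)" if "i < n" "j < n" for i j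
    using index_transpose_mat(1)[of i A j] An that by (simp add: tA)
  have "\<exists>c L. edges (S i) = (\<lambda>x. {c, x}) ` L \<and> c \<in> verts G" if "i \<in> {1..k}" for i
  proof -
    have star: "simple_star (S i)" and sub: "subgraph_of (S i) G"
      using S that by (auto simp: edge_star_cover_def)
    obtain c L where "S i = Graph (insert c L) ((\<lambda>x. {c, x}) ` L)"
      using star unfolding simple_star_def by blast
    then show ?thesis using sub by (intro exI[of _ c] exI[of _ L]) (simp add: subgraph_of_def)
  qed
  then obtain c L where cL: "\<And>i. i \<in> {1..k} \<Longrightarrow> edges (S i) = (\<lambda>x. {c i, x}) ` L i"
    and cv: "\<And>i. i \<in> {1..k} \<Longrightarrow> c i \<in> verts G" by metis
  have cn: "c (Suc i) < n" if "i < k" for i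
    using cv[of "Suc i"] that An A(2) by (auto simp: pattern_graph_def)
  \<comment> \<open>The star responsible for an edge; indices are shifted from \<open>{1..k}\<close> to \<open>{..<k}\<close>.\<close>
  have "\<exists>i<k. e \<in> edges (S (Suc i))" if "e \<in> edges G" for e
  proof -
    have "e \<in> (\<Union>i\<in>{1..k}. edges (S i))" using S that by (simp add: edge_star_cover_def)
    then obtain i where "i \<in> {1..k}" "e \<in> edges (S i)" by (rule UN_E)
    then show ?thesis by (intro exI[of _ "i - 1"]) auto
  qed
  then obtain f where f: "\<And>e. e \<in> edges G \<Longrightarrow> f e < k" "\<And>e. e \<in> edges G \<Longrightarrow> e \<in> edges (S (Suc (f e)))"
    by metis
  define g :: "nat \<Rightarrow> nat \<Rightarrow> real" where "g i x = (if x = c (Suc i) then 1 else 0)" for i x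
  define h where "h i x = (if f {c (Suc i), x} = i then A $$ (c (Suc i), x) else 0)" for i x
  show ?thesis
  proof (rule st_plus_le_two_mult_swap_sum[OF An])
    show "0 \<le> g i x" for i x by (simp add: g_def)
    show "0 \<le> h i x" if "i < k" "x < n" for i x using nn cn that by (simp add: h_def)
    show "A $$ (x, y) = (\<Sum>i<k. g i x * h i y + h i x * g i y)" (is "_ = sum ?t _")
      if xy: "x < n" "y < n" for x y
    proof (cases "{x, y} \<in> edges G")
      case False
      then have "A $$ (x, y) = 0" using pattern_graph_edge_iff[OF A xy] by simp
      then have "?t i = 0" for i using sym[OF xy] by (auto simp: g_def h_def)
      then show ?thesis using \<open>A $$ (x, y) = 0\<close> by simp
    next
      case True
      have "x \<noteq> y" using True assms(1) by (auto simp: loopless_def)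
      have "{x, y} \<in> (\<lambda>z. {c (Suc (f {x, y})), z}) ` L (Suc (f {x, y}))"
        using f[OF True] cL[of "Suc (f {x, y})"] by auto
      then have "c (Suc (f {x, y})) = x \<or> c (Suc (f {x, y})) = y" by (auto simp: doubleton_eq_iff)
      then have "?t (f {x, y}) = A $$ (x, y)"
        using \<open>x \<noteq> y\<close> sym[OF xy] by (auto simp: g_def h_def insert_commute)
      moreover have "?t i = 0" if "i \<noteq> f {x, y}" for i
        using that by (auto simp: g_def h_def insert_commute)
      then have "sum ?t {..<k} = sum ?t {f {x, y}}"
        using f(1)[OF True] by (intro sum.mono_neutral_right) auto
      ultimately show ?thesis by simp
    qed
  qed
qed

theorem proposition3p2:
  fixes T :: "nat graph" and n :: nat
  assumes "forest T" and "verts T = {0..<n}"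
  shows "(\<forall>A\<in>S_plus_graph T. vec_space.rank n A = st_plus A \<and> st_plus A = 2 * star T) \<and>
         st_plus_graph T = 2 * star T"
proof -
  have G: "fin_graph T" "loopless T" using assms(1) by (auto simp: forest_def)
  obtain S where S: "edge_star_cover T (star T) S"
    using LeastI_ex[OF edge_star_cover_exists[OF G]] unfolding star_def by blast
  have main: "vec_space.rank n A = st_plus A \<and> st_plus A = 2 * star T" if "A \<in> S_plus_graph T" for A
  proof -
    have A: "A \<in> S_plus n" "pattern_graph A = T" using that assms(2) by (auto simp: S_plus_graph_def)
    show ?thesis
      using two_star_le_rank[OF assms(1) A] rank_le_st_plus[OF A(1)] st_plus_le_two_mult_cover[OF G(2) A S]
      by linarith
  qed
  obtain A where "A \<in> S_plus_graph T" using S_plus_graph_nonempty[OF G(1) assms(2)] by blast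
  then have "st_plus_graph T = 2 * star T" unfolding st_plus_graph_def
    by (intro Least_equality) (use main in force)+
  then show ?thesis using main by blast
qed

end
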